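(* For every positive integer $c$ there exists $m_0$ such that for every integer $m \geq m_0$ the following holds: if $F$ is a binary image consisting of $m^2$ ones and having a boundary of length $4m+4c$, then the largest connected component of $F$ consists of at least $m^2-c^2$ ones.
   Context: A cell is a unit square in $\mathbb{R}^2$ whose vertices have integer coordinates. A binary image is a (finite) rectangle in $\mathbb{R}^2$ made up of cells, in which each cell has been assigned a value $0$ or $1$. A cell with value $1$ is called a one, a cell with value $0$ a zero; the image consists of $N$ ones if exactly $N$ of its cells have value $1$. Two cells are neighbours if they have a common edge. Two ones $c, c'$ are connected if there is a path $c=c_1,\dots,c_n=c'$ of ones with $c_i$ and $c_{i+1}$ neighbours for $1\le i\le n-1$; the equivalence classes of this relation are the connected components of the image. An edge of a cell belongs to the boundary of the image if it is the common edge of two neighbouring cells of the rectangle, one with value $1$ and one with value $0$, or if it belongs to exactly one cell of the rectangle (i.e. lies on the outer edge of the rectangle) and that cell has value $1$. The length of the boundary is the number of edges belonging to the boundary. *)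

theory Defs
  imports Main
begin

text \<open>
  Points of the integer lattice are pairs of integers.  The unit square with vertices
  \<open>(i, j), (i + 1, j), (i, j + 1), (i + 1, j + 1)\<close> is represented by its lower left
  vertex \<open>(i, j)\<close>, and the unit segment between two adjacent lattice points by
  the set of its two endpoints.
\<close>

type_synonym point = "int \<times> int"
type_synonym cell = point
type_synonym edge = "point set"

fun edges_of :: "cell \<Rightarrow> edge set" where
  "edges_of (i, j) =
     {{(i, j), (i + 1, j)}, {(i, j + 1), (i + 1, j + 1)},
      {(i, j), (i, j + 1)}, {(i + 1, j), (i + 1, j + 1)}}"

definition neighbours :: "cell \<Rightarrow> cell \<Rightarrow> bool" where
  "neighbours c d \<longleftrightarrow> c \<noteq> d \<and> edges_of c \<inter> edges_of d \<noteq> {}"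

definition rectangle :: "cell set \<Rightarrow> bool" where
  "rectangle R \<longleftrightarrow>
     (\<exists>a a' b b'. a < a' \<and> b < b' \<and> R = {a..<a'} \<times> {b..<b'})"

text \<open>
  An image is given by its set of cells \<open>R\<close> and its value assignment \<open>F\<close>.  The values
  of \<open>F\<close> outside \<open>R\<close> carry no meaning, so every notion below is relative to \<open>R\<close>.
\<close>

definition binary_image :: "cell set \<Rightarrow> (cell \<Rightarrow> nat) \<Rightarrow> bool" where
  "binary_image R F \<longleftrightarrow> rectangle R \<and> (\<forall>c\<in>R. F c \<in> {0, 1})"

definition ones :: "cell set \<Rightarrow> (cell \<Rightarrow> nat) \<Rightarrow> cell set" where
  "ones R F = {c \<in> R. F c = 1}"

definition connected_ones :: "cell set \<Rightarrow> (cell \<Rightarrow> nat) \<Rightarrow> cell rel" where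
  "connected_ones R F =
     {(c, c'). \<exists>p. p \<noteq> [] \<and> hd p = c \<and> last p = c' \<and> set p \<subseteq> ones R F \<and> successively neighbours p}"

definition components :: "cell set \<Rightarrow> (cell \<Rightarrow> nat) \<Rightarrow> cell set set" where
  "components R F = ones R F // connected_ones R F"

definition boundary :: "cell set \<Rightarrow> (cell \<Rightarrow> nat) \<Rightarrow> edge set" where
  "boundary R F =
     {e. (\<exists>c\<in>R. \<exists>d\<in>R. neighbours c d \<and> e \<in> edges_of c \<inter> edges_of d \<and> F c = 1 \<and> F d = 0) \<or>
         (\<exists>c. {d \<in> R. e \<in> edges_of d} = {c} \<and> F c = 1)}"

text \<open>The maximum is only meaningful if the image contains a one.\<close>

definition largest_component_size :: "cell set \<Rightarrow> (cell \<Rightarrow> nat) \<Rightarrow> nat" where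
  "largest_component_size R F = Max (card ` components R F)"

end

(* Every nonempty row and every nonempty column of a component contributes two boundary edges, and
   distinct components have disjoint sets of edges; hence by AM-GM the boundary has length at least
   four times the sum of the square roots of the component sizes.  Let L be the largest size.  The
   sum of the square roots is at least m^2 / sqrt L, so sqrt L >= m - c, and, by subadditivity, at
   least sqrt L + sqrt (m^2 - L), which for L < m^2 - c^2 is more than m + c once m is large. *)

theory Submission
  imports Defs Complex_Main
begin

section \<open>Square roots of the parts of a square\<close>

text \<open>Serves to merge all components other than the largest into one part of their total
  size.\<close>

lemma sqrt_sum_le_sum_sqrt:
  fixes f :: "'a \<Rightarrow> real"
  assumes "finite A" and "\<And>a. a \<in> A \<Longrightarrow> f a \<ge> 0"
  shows "sqrt (sum f A) \<le> (\<Sum>a\<in>A. sqrt (f a))"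
  using assms
proof (induction A rule: finite_induct)
  case (insert a A)
  have "sqrt (f a + sum f A) \<le> sqrt (f a) + sqrt (sum f A)"
    using insert by (intro sqrt_add_le_add_sqrt sum_nonneg) auto
  then show ?case
    using insert by fastforce
qed simp

text \<open>Here \<open>x\<close> stands for the root of the largest part and \<open>s\<close> for
  the root of the rest. By \<open>pyth\<close> and \<open>sum\<close> alone \<open>s\<close> could
  also be close to \<open>m\<close>; \<open>prod\<close> rules this out by forcing \<open>x\<close>
  to be at least \<open>m - c\<close>. Then \<open>s\<close> exceeds \<open>c\<close> by at most
  \<open>c\<^sup>2 / m\<close>, so \<open>s\<^sup>2\<close> exceeds \<open>c\<^sup>2\<close> by less
  than 1.\<close>

lemma sqrt_defect_bound:
  fixes m c x s :: real
  assumes c: "c > 0" and m: "m \<ge> 8 * c" "m > 3 * c ^ 3" and nonneg: "x \<ge> 0" "s \<ge> 0"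
    and pyth: "x\<^sup>2 + s\<^sup>2 = m\<^sup>2" and prod: "m\<^sup>2 \<le> x * (m + c)" and sum: "x + s \<le> m + c"
  shows "s\<^sup>2 < c\<^sup>2 + 1"
proof (rule ccontr)
  assume "\<not> s\<^sup>2 < c\<^sup>2 + 1"
  then have big: "s\<^sup>2 \<ge> c\<^sup>2 + 1" by simp
  have "s > c"
    by (rule power2_less_imp_less) (use big nonneg in auto)
  have "(m - c) * (m + c) \<le> m\<^sup>2"
    by (simp add: algebra_simps power2_eq_square)
  also note prod
  finally have "(m - c) * (m + c) \<le> x * (m + c)" .
  then have "m - c \<le> x"
    using m c by simp
  then have "(m - c)\<^sup>2 \<le> x\<^sup>2"
    using m c by (intro power_mono) auto
  then have "s\<^sup>2 \<le> 2 * m * c - c\<^sup>2"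
    using pyth by (simp add: power2_eq_square algebra_simps)
  also have "\<dots> \<le> 2 * m * c"
    by simp
  \<comment> \<open>The constant 8 is chosen so that the bound becomes the square of
    \<open>m / 2\<close>.\<close>
  also have "\<dots> \<le> 2 * m * (m / 8)"
    using m c by (intro mult_left_mono) auto
  also have "\<dots> = (m / 2)\<^sup>2"
    by (simp add: power2_eq_square)
  finally have half: "s \<le> m / 2"
    by (rule power2_le_imp_le) (use m c in auto)
  \<comment> \<open>Squaring the bound on \<open>x + s\<close> and substituting
    \<open>m\<^sup>2 - s\<^sup>2\<close> for \<open>x\<^sup>2\<close> leaves a product with factor
    \<open>s - c\<close>; the other factor, \<open>m - s\<close>, is at least
    \<open>m / 2\<close>.\<close>
  have "x\<^sup>2 \<le> (m + c - s)\<^sup>2"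
    using nonneg sum by (intro power_mono) auto
  then have "2 * ((s - c) * (m - s)) \<le> c\<^sup>2"
    using pyth by (simp add: power2_eq_square algebra_simps)
  moreover have "(s - c) * (m / 2) \<le> (s - c) * (m - s)"
    using half \<open>s > c\<close> by (intro mult_left_mono) auto
  ultimately have gap: "(s - c) * m \<le> c\<^sup>2"
    by simp
  have "c\<^sup>2 \<le> c * m"
    using m c by (simp add: power2_eq_square)
  with gap have "(s - c) * m \<le> c * m"
    by simp
  then have "s - c \<le> c"
    using m c by simp
  \<comment> \<open>The crude bound \<open>s \<le> 2 * c\<close> just obtained gives
    \<open>s + c \<le> 3 * c\<close>, which is the source of the threshold
    \<open>3 * c ^ 3\<close>.\<close>
  have "m \<le> (s\<^sup>2 - c\<^sup>2) * m"
    using big m c by simp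
  also have "\<dots> = (s - c) * m * (s + c)"
    by (simp add: power2_eq_square algebra_simps)
  also have "\<dots> \<le> c\<^sup>2 * (3 * c)"
    using gap \<open>s > c\<close> \<open>s - c \<le> c\<close> c m by (intro mult_mono) auto
  also have "\<dots> = 3 * c ^ 3"
    by (simp add: power2_eq_square power3_eq_cube)
  finally show False
    using m by simp
qed

lemma largest_part_of_square:
  fixes k :: "'a \<Rightarrow> nat" and m c :: nat
  assumes fin: "finite I" and i: "i \<in> I" and max: "\<And>j. j \<in> I \<Longrightarrow> k j \<le> k i"
    and total: "(\<Sum>j\<in>I. k j) = m\<^sup>2" and roots: "(\<Sum>j\<in>I. sqrt (k j)) \<le> real m + real c"
    and c: "c > 0" and m: "m \<ge> 8 * c" "m > 3 * c ^ 3"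
  shows "m\<^sup>2 \<le> k i + c\<^sup>2"
proof -
  define x where "x = sqrt (k i)"
  define s where "s = sqrt (\<Sum>j\<in>I - {i}. real (k j))"
  have rest: "s\<^sup>2 = (\<Sum>j\<in>I - {i}. real (k j))"
    unfolding s_def by (simp add: sum_nonneg)
  have rtotal: "(\<Sum>j\<in>I. real (k j)) = (real m)\<^sup>2"
    using total by (metis of_nat_power of_nat_sum)
  have pyth: "x\<^sup>2 + s\<^sup>2 = (real m)\<^sup>2"
    using sum.remove[OF fin i, of "\<lambda>j. real (k j)"] rtotal rest by (simp add: x_def)
  have "(real m)\<^sup>2 = (\<Sum>j\<in>I. sqrt (k j) * sqrt (k j))"
    using rtotal by simp
  \<comment> \<open>One of the two equal factors is replaced by the largest root.\<close>
  also have "\<dots> \<le> (\<Sum>j\<in>I. x * sqrt (k j))"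
    unfolding x_def using max by (intro sum_mono mult_right_mono) auto
  also have "\<dots> = x * (\<Sum>j\<in>I. sqrt (k j))"
    by (simp add: sum_distrib_left)
  also have "\<dots> \<le> x * (real m + real c)"
    using roots by (intro mult_left_mono) (auto simp: x_def)
  finally have prod: "(real m)\<^sup>2 \<le> x * (real m + real c)" .
  have "s \<le> (\<Sum>j\<in>I - {i}. sqrt (k j))"
    unfolding s_def using fin by (intro sqrt_sum_le_sum_sqrt) auto
  then have "x + s \<le> real m + real c"
    using sum.remove[OF fin i, of "\<lambda>j. sqrt (k j)"] roots by (simp add: x_def)
  moreover have "real m \<ge> 8 * real c"
    using m(1) by linarith
  moreover have "real m > 3 * real c ^ 3"
    using of_nat_less_iff[where 'a = real, THEN iffD2, OF m(2)] by simp
  moreover have "x \<ge> 0" "s \<ge> 0"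
    by (auto simp: x_def s_def sum_nonneg)
  ultimately have "s\<^sup>2 < (real c)\<^sup>2 + 1"
    using sqrt_defect_bound[of "real c" "real m" x s] pyth prod c by simp
  then have "(real m)\<^sup>2 < real (k i) + (real c)\<^sup>2 + 1"
    using pyth by (simp add: x_def)
  \<comment> \<open>Both sides are natural numbers, so the strict inequality absorbs the 1.\<close>
  then have "real (m\<^sup>2) < real (k i + c\<^sup>2 + 1)"
    by simp
  then show ?thesis
    by linarith
qed

section \<open>Components\<close>

lemma neighbours_sym: "neighbours c d \<Longrightarrow> neighbours d c"
  by (auto simp: neighbours_def)

lemma neighboursI:
  "c \<noteq> d \<Longrightarrow> e \<in> edges_of c \<Longrightarrow> e \<in> edges_of d \<Longrightarrow> neighbours c d"
  unfolding neighbours_def by blast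

lemma equiv_connected_ones: "equiv (ones R F) (connected_ones R F)"
proof (rule equivI)
  show "connected_ones R F \<subseteq> ones R F \<times> ones R F"
    unfolding connected_ones_def by (auto dest: hd_in_set last_in_set)
  show "refl_on (ones R F) (connected_ones R F)"
    unfolding refl_on_def connected_ones_def
    by (auto intro!: exI[of _ "[c]" for c])
  show "sym (connected_ones R F)"
  proof (rule symI)
    fix c d assume "(c, d) \<in> connected_ones R F"
    then obtain p where p: "p \<noteq> []" "hd p = c" "last p = d" "set p \<subseteq> ones R F"
        "successively neighbours p"
      unfolding connected_ones_def by auto
    have "successively neighbours (rev p)"
      using p(5) by (auto simp: neighbours_sym elim: successively_mono)
    with p show "(d, c) \<in> connected_ones R F"
      unfolding connected_ones_def by (auto simp: hd_rev last_rev intro!: exI[of _ "rev p"])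
  qed
  show "trans (connected_ones R F)"
  proof (rule transI)
    fix c d e assume "(c, d) \<in> connected_ones R F" "(d, e) \<in> connected_ones R F"
    then obtain p q where p: "p \<noteq> []" "hd p = c" "last p = d" "set p \<subseteq> ones R F"
        "successively neighbours p"
      and q: "q \<noteq> []" "hd q = d" "last q = e" "set q \<subseteq> ones R F" "successively neighbours q"
      unfolding connected_ones_def by auto
    \<comment> \<open>The meeting point \<open>d\<close> must occur only once in the joined path,
      since no cell is its own neighbour.\<close>
    obtain q' where q': "q = d # q'"
      using q by (cases q) auto
    have "successively neighbours (p @ q')" "last (p @ q') = e"
      using p q q' by (auto simp: successively_append_iff successively_Cons)
    with p q q' show "(c, e) \<in> connected_ones R F"
      unfolding connected_ones_def by (auto intro!: exI[of _ "p @ q'"])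
  qed
qed

lemma component_subset: "K \<in> components R F \<Longrightarrow> K \<subseteq> ones R F"
  unfolding components_def using equiv_connected_ones by (rule in_quotient_imp_subset)

lemma components_disjoint:
  "K \<in> components R F \<Longrightarrow> K' \<in> components R F \<Longrightarrow> K = K' \<or> K \<inter> K' = {}"
  unfolding components_def using equiv_connected_ones by (rule quotient_disj)

lemma Union_components: "\<Union> (components R F) = ones R F"
  unfolding components_def using equiv_connected_ones by (rule Union_quotient)

text \<open>The two cells form a path. Hence a cell across an edge of a component either belongs to
  that component or is not a one.\<close>

lemma neighbours_in_component:
  assumes "K \<in> components R F" "c \<in> K" "d \<in> ones R F" "neighbours c d"
  shows "d \<in> K"
proof -
  have "c \<in> ones R F"
    using assms component_subset by blast
  with assms have "(c, d) \<in> connected_ones R F"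
    unfolding connected_ones_def by (auto intro!: exI[of _ "[c, d]"])
  then show ?thesis
    using assms equiv_connected_ones unfolding components_def
    by (meson in_quotient_imp_closed)
qed

lemma finite_rectangle: "rectangle R \<Longrightarrow> finite R"
  by (auto simp: rectangle_def)

lemma finite_ones: "finite R \<Longrightarrow> finite (ones R F)"
  by (simp add: ones_def)

lemma finite_components: "finite R \<Longrightarrow> finite (components R F)"
  unfolding components_def
  by (meson equiv_connected_ones equiv_type finite_ones finite_quotient)

lemma finite_component: "finite R \<Longrightarrow> K \<in> components R F \<Longrightarrow> finite K"
  by (meson component_subset finite_ones finite_subset)

lemma sum_card_components:
  assumes "finite R"
  shows "(\<Sum>K\<in>components R F. card K) = card (ones R F)"
  using assms components_disjoint[of _ R F]
  by (subst Union_components[symmetric], subst card_Union_disjoint)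
     (auto simp: pairwise_def disjnt_def intro: finite_component)

section \<open>The boundary of a component\<close>

lemma finite_edges_of: "finite (edges_of c)"
  by (cases c) simp

lemma finite_boundary:
  assumes "finite R"
  shows "finite (boundary R F)"
proof (rule finite_subset)
  show "boundary R F \<subseteq> (\<Union>c\<in>R. edges_of c)"
    unfolding boundary_def by blast
qed (use assms finite_edges_of in auto)

section \<open>Lattice edges and the cells on either side of them\<close>

lemma doubleton_Pair_eq_iff:
  "{(a, b), (a', b')} = {(i, j), (i', j')} \<longleftrightarrow>
     a = i \<and> b = j \<and> a' = i' \<and> b' = j' \<or> a = i' \<and> b = j' \<and> a' = i \<and> b' = j"
  by (auto simp: doubleton_eq_iff)

text \<open>An edge is an unordered pair, but matching the endpoints crosswise would need a number
  to equal itself plus 2, or clash in the other coordinate.\<close>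

lemma edge_eq_simps:
  fixes a b i j :: int
  shows "{(a, b), (a, b + 1)} = {(i, j), (i, j + 1)} \<longleftrightarrow> a = i \<and> b = j"
    and "{(a, b), (a + 1, b)} = {(i, j), (i + 1, j)} \<longleftrightarrow> a = i \<and> b = j"
    and "{(a, b), (a, b + 1)} \<noteq> {(i, j), (i + 1, j)}"
    and "{(a, b), (a + 1, b)} \<noteq> {(i, j), (i, j + 1)}"
  unfolding doubleton_Pair_eq_iff by linarith+

text \<open>Identifies the only cell across the edge: once that cell is known to be outside a
  component, the edge is a boundary edge.\<close>

lemma vertical_edge_in_edges_of:
  "{(i, j), (i, j + 1)} \<in> edges_of d \<longleftrightarrow> d = (i, j) \<or> d = (i - 1, j)"
  by (cases d) (auto simp: edge_eq_simps)

lemma horizontal_edge_in_edges_of: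
  "{(i, j), (i + 1, j)} \<in> edges_of d \<longleftrightarrow> d = (i, j) \<or> d = (i, j - 1)"
  by (cases d) (auto simp: edge_eq_simps)

section \<open>Distribution of the boundary over the components\<close>

definition component_boundary :: "cell set \<Rightarrow> (cell \<Rightarrow> nat) \<Rightarrow> cell set \<Rightarrow> edge set" where
  "component_boundary R F K = boundary R F \<inter> (\<Union>c\<in>K. edges_of c)"

text \<open>A common edge would make a cell of one component a neighbour of a cell of the other, and
  both cells are ones.\<close>

lemma component_boundaries_disjoint:
  assumes "K \<in> components R F" "K' \<in> components R F" "K \<noteq> K'"
  shows "component_boundary R F K \<inter> component_boundary R F K' = {}"
proof (rule ccontr)
  assume "\<not> ?thesis"
  then obtain e c d where e: "c \<in> K" "d \<in> K'" "e \<in> edges_of c" "e \<in> edges_of d"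
    unfolding component_boundary_def by blast
  have disj: "K \<inter> K' = {}"
    using assms components_disjoint by blast
  then have "c \<noteq> d"
    using e(1,2) by blast
  then have "neighbours c d"
    using e(3,4) by (rule neighboursI)
  then have "d \<in> K"
    using assms e component_subset by (blast intro: neighbours_in_component[of K R F c])
  with e disj show False
    by blast
qed

text \<open>If \<open>c\<close> is the only cell of \<open>R\<close> at \<open>e\<close>, the edge
  is on the outer edge of the rectangle. Otherwise the other cell is a zero, which puts
  \<open>e\<close> in the boundary, or a one, which then lies in \<open>K\<close>.\<close>

lemma edge_of_component_cases:
  assumes img: "binary_image R F" and K: "K \<in> components R F" and c: "c \<in> K" "e \<in> edges_of c"
  shows "e \<in> component_boundary R F K \<or> (\<exists>d\<in>K. d \<noteq> c \<and> e \<in> edges_of d)"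
proof (cases "{d \<in> R. e \<in> edges_of d} = {c}")
  case True
  then have "e \<in> boundary R F"
    using c component_subset[OF K] unfolding boundary_def ones_def by blast
  with c show ?thesis
    unfolding component_boundary_def by blast
next
  case False
  have one: "c \<in> R" "F c = 1"
    using c component_subset[OF K] unfolding ones_def by auto
  then obtain d where d: "d \<in> R" "d \<noteq> c" "e \<in> edges_of d"
    using False c by blast
  then have nb: "neighbours c d"
    using c(2) by (metis neighboursI)
  consider "F d = 0" | "F d = 1"
    using img d(1) by (auto simp: binary_image_def)
  then show ?thesis
  proof cases
    case 1
    then have "e \<in> boundary R F"
      unfolding boundary_def using one d(1,3) nb c(2) by fast
    with c show ?thesis
      unfolding component_boundary_def by blast
  next
    case 2
    then have "d \<in> K"
      using neighbours_in_component[OF K c(1) _ nb] d(1) by (simp add: ones_def)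
    with d show ?thesis
      by blast
  qed
qed

text \<open>Only the two extreme cells of each nonempty row and column are used: the cell beyond an
  extreme one is not in \<open>K\<close>, so their common edge is a boundary edge.\<close>

lemma card_component_boundary_ge:
  assumes img: "binary_image R F" and K: "K \<in> components R F"
  shows "2 * (card (fst ` K) + card (snd ` K)) \<le> card (component_boundary R F K)"
proof -
  have finR: "finite R"
    using img by (auto simp: binary_image_def finite_rectangle)
  have fin: "finite K"
    using finR K by (rule finite_component)
  define row where "row j = {i. (i, j) \<in> K}" for j
  define col where "col i = {j. (i, j) \<in> K}" for i
  have finrow: "finite (row j)" for j
    by (rule finite_subset[of _ "fst ` K"]) (use fin in \<open>force simp: row_def\<close>)+
  have fincol: "finite (col i)" for i
    by (rule finite_subset[of _ "snd ` K"]) (use fin in \<open>force simp: col_def\<close>)+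
  have nerow: "row j \<noteq> {}" if "j \<in> snd ` K" for j
    using that by (auto simp: row_def)
  have necol: "col i \<noteq> {}" if "i \<in> fst ` K" for i
    using that by (auto simp: col_def)
  \<comment> \<open>A cell is named by its lower left vertex, so its right and top edges lie one
    unit further, hence the \<open>+ 1\<close> at the maxima.\<close>
  define left where "left j = {(Min (row j), j), (Min (row j), j + 1)}" for j
  define right where "right j = {(Max (row j) + 1, j), (Max (row j) + 1, j + 1)}" for j
  define bottom where "bottom i = {(i, Min (col i)), (i + 1, Min (col i))}" for i
  define top where "top i = {(i, Max (col i) + 1), (i + 1, Max (col i) + 1)}" for i
  have left: "left j \<in> component_boundary R F K" if j: "j \<in> snd ` K" for j
  proof -
    have "(Min (row j), j) \<in> K"
      using Min_in[OF finrow nerow[OF j]] by (simp add: row_def)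
    moreover have "(Min (row j) - 1, j) \<notin> K"
      using Min_le[OF finrow, of "Min (row j) - 1" j] by (auto simp: row_def)
    ultimately show ?thesis
      using edge_of_component_cases[OF img K, of "(Min (row j), j)" "left j"]
      unfolding left_def vertical_edge_in_edges_of by blast
  qed
  have right: "right j \<in> component_boundary R F K" if j: "j \<in> snd ` K" for j
  proof -
    have "(Max (row j), j) \<in> K"
      using Max_in[OF finrow nerow[OF j]] by (simp add: row_def)
    moreover have "(Max (row j) + 1, j) \<notin> K"
      using Max_ge[OF finrow, of "Max (row j) + 1" j] by (auto simp: row_def)
    ultimately show ?thesis
      using edge_of_component_cases[OF img K, of "(Max (row j), j)" "right j"]
      unfolding right_def vertical_edge_in_edges_of by auto
  qed
  have bottom: "bottom i \<in> component_boundary R F K" if i: "i \<in> fst ` K" for i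
  proof -
    have "(i, Min (col i)) \<in> K"
      using Min_in[OF fincol necol[OF i]] by (simp add: col_def)
    moreover have "(i, Min (col i) - 1) \<notin> K"
      using Min_le[OF fincol, of "Min (col i) - 1" i] by (auto simp: col_def)
    ultimately show ?thesis
      using edge_of_component_cases[OF img K, of "(i, Min (col i))" "bottom i"]
      unfolding bottom_def horizontal_edge_in_edges_of by blast
  qed
  have top: "top i \<in> component_boundary R F K" if i: "i \<in> fst ` K" for i
  proof -
    have "(i, Max (col i)) \<in> K"
      using Max_in[OF fincol necol[OF i]] by (simp add: col_def)
    moreover have "(i, Max (col i) + 1) \<notin> K"
      using Max_ge[OF fincol, of "Max (col i) + 1" i] by (auto simp: col_def)
    ultimately show ?thesis
      using edge_of_component_cases[OF img K, of "(i, Max (col i))" "top i"]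
      unfolding top_def horizontal_edge_in_edges_of by auto
  qed
  have inj: "inj_on left (snd ` K)" "inj_on right (snd ` K)"
      "inj_on bottom (fst ` K)" "inj_on top (fst ` K)"
    by (auto simp: inj_on_def left_def right_def bottom_def top_def edge_eq_simps)
  \<comment> \<open>Edges from different rows differ anyway; within one row the left and right edges
    must be told apart, even if the row is a single cell.\<close>
  have "Min (row j) \<noteq> Max (row j) + 1" if "j \<in> snd ` K" for j
    using Min_le[OF finrow Max_in[OF finrow nerow[OF that]]] by simp
  then have "left ` snd ` K \<inter> right ` snd ` K = {}"
    by (fastforce simp: left_def right_def edge_eq_simps)
  then have card_vertical: "card (left ` snd ` K \<union> right ` snd ` K) = 2 * card (snd ` K)"
    using inj fin by (simp add: card_Un_disjoint card_image)
  have "Min (col i) \<noteq> Max (col i) + 1" if "i \<in> fst ` K" for i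
    using Min_le[OF fincol Max_in[OF fincol necol[OF that]]] by simp
  then have "bottom ` fst ` K \<inter> top ` fst ` K = {}"
    by (fastforce simp: bottom_def top_def edge_eq_simps)
  then have card_horizontal: "card (bottom ` fst ` K \<union> top ` fst ` K) = 2 * card (fst ` K)"
    using inj fin by (simp add: card_Un_disjoint card_image)
  have "(left ` snd ` K \<union> right ` snd ` K) \<inter> (bottom ` fst ` K \<union> top ` fst ` K) = {}"
    by (auto simp: left_def right_def bottom_def top_def edge_eq_simps)
  then have "2 * (card (fst ` K) + card (snd ` K))
      = card ((left ` snd ` K \<union> right ` snd ` K) \<union> (bottom ` fst ` K \<union> top ` fst ` K))"
    using fin card_vertical card_horizontal by (subst card_Un_disjoint) auto
  also have "\<dots> \<le> card (component_boundary R F K)"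
  proof (rule card_mono)
    show "finite (component_boundary R F K)"
      using finite_boundary[OF finR] by (simp add: component_boundary_def)
  qed (use left right bottom top in blast)
  finally show ?thesis .
qed

text \<open>\<open>K\<close> lies in the product of its two projections, so its size is at most the
  product of their sizes, and AM-GM compares the root of that product with half their sum.\<close>

lemma sqrt_card_le_component_boundary:
  assumes img: "binary_image R F" and K: "K \<in> components R F"
  shows "4 * sqrt (card K) \<le> card (component_boundary R F K)"
proof -
  let ?w = "card (fst ` K)" and ?h = "card (snd ` K)"
  have fin: "finite K"
    using img K by (auto simp: binary_image_def intro: finite_component finite_rectangle)
  have "card K \<le> card (fst ` K \<times> snd ` K)"
    using fin by (intro card_mono) (auto simp: subset_fst_snd)
  then have "real (card K) \<le> real ?w * real ?h"
    by (simp add: card_cartesian_product flip: of_nat_mult)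
  then have "sqrt (card K) \<le> sqrt (real ?w * real ?h)"
    by simp
  also have "\<dots> \<le> (real ?w + real ?h) / 2"
    by (rule arith_geo_mean_sqrt) auto
  finally have "4 * sqrt (card K) \<le> real (2 * (?w + ?h))"
    by simp
  also have "\<dots> \<le> real (card (component_boundary R F K))"
    using card_component_boundary_ge[OF img K] by (rule of_nat_mono)
  finally show ?thesis .
qed

lemma sum_sqrt_components_le_boundary:
  assumes img: "binary_image R F"
  shows "4 * (\<Sum>K\<in>components R F. sqrt (card K)) \<le> card (boundary R F)"
proof -
  have finR: "finite R"
    using img by (auto simp: binary_image_def finite_rectangle)
  have "4 * (\<Sum>K\<in>components R F. sqrt (card K))
      \<le> (\<Sum>K\<in>components R F. real (card (component_boundary R F K)))"
    unfolding sum_distrib_left by (intro sum_mono sqrt_card_le_component_boundary img)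
  \<comment> \<open>No boundary edge is counted for two components.\<close>
  also have "\<dots> = real (card (\<Union>K\<in>components R F. component_boundary R F K))"
    using finR finite_boundary[OF finR] component_boundaries_disjoint[of _ R F]
    by (subst card_UN_disjoint) (auto simp: finite_components component_boundary_def)
  also have "\<dots> \<le> real (card (boundary R F))"
    using finite_boundary[OF finR]
    by (intro of_nat_mono card_mono) (auto simp: component_boundary_def)
  finally show ?thesis .
qed

section \<open>The bound on the largest component\<close>

theorem theorem1:
  "\<forall>c::nat. c > 0 \<longrightarrow>
     (\<exists>m0::nat. \<forall>m\<ge>m0. \<forall>R F.
        binary_image R F \<and> card (ones R F) = m\<^sup>2 \<and> card (boundary R F) = 4 * m + 4 * c \<longrightarrow>
        int (largest_component_size R F) \<ge> (int m)\<^sup>2 - (int c)\<^sup>2)"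
proof (intro allI impI)
  fix c :: nat
  assume c: "c > 0"
  show "\<exists>m0::nat. \<forall>m\<ge>m0. \<forall>R F.
        binary_image R F \<and> card (ones R F) = m\<^sup>2 \<and> card (boundary R F) = 4 * m + 4 * c \<longrightarrow>
        int (largest_component_size R F) \<ge> (int m)\<^sup>2 - (int c)\<^sup>2"
  \<comment> \<open>The sum dominates both thresholds of \<open>largest_part_of_square\<close>; the
    final 1 makes the second one strict.\<close>
  proof (intro exI[of _ "8 * c + 3 * c ^ 3 + 1"] allI impI, elim conjE)
    fix m R F
    assume m: "m \<ge> 8 * c + 3 * c ^ 3 + 1" and img: "binary_image R F"
      and area: "card (ones R F) = m\<^sup>2" and len: "card (boundary R F) = 4 * m + 4 * c"
    have finR: "finite R"
      using img by (auto simp: binary_image_def finite_rectangle)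
    have fin: "finite (card ` components R F)"
      using finR by (simp add: finite_components)
    \<comment> \<open>Since \<open>m\<close> is positive there is a component, so the
      \<open>Max\<close> is over a nonempty set and is attained by some \<open>K\<close>.\<close>
    have "ones R F \<noteq> {}"
      using area m by auto
    then have "components R F \<noteq> {}"
      using Union_components by fastforce
    then have "largest_component_size R F \<in> card ` components R F"
      unfolding largest_component_size_def using fin by (intro Max_in) auto
    then obtain K where K: "K \<in> components R F" "largest_component_size R F = card K"
      by blast
    have "m\<^sup>2 \<le> card K + c\<^sup>2"
    proof (rule largest_part_of_square[where k = card and I = "components R F"])
      show "card K' \<le> card K" if "K' \<in> components R F" for K'
        using that fin unfolding K(2)[symmetric] largest_component_size_def by simp
      show "(\<Sum>K\<in>components R F. sqrt (card K)) \<le> real m + real c"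
        using sum_sqrt_components_le_boundary[OF img] len by simp
      show "finite (components R F)"
        using finR by (rule finite_components)
      show "(\<Sum>K\<in>components R F. card K) = m\<^sup>2"
        using sum_card_components[OF finR] area by simp
    qed (use K c m in auto)
    then have "int (m\<^sup>2) \<le> int (card K + c\<^sup>2)"
      by (rule of_nat_mono)
    then show "int (largest_component_size R F) \<ge> (int m)\<^sup>2 - (int c)\<^sup>2"
      using K by simp
  qed
qed

end
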